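(* Let $G_1=(V_1,E_1)$ and $G_2=(V_2,E_2)$ be two locally finite graphs and let $G_1\times_K G_2$ be their Kronecker product. For $o_1\in V_1$ and $o_2\in V_2$ we have \[ W_m((o_1,o_2);G_1\times_K G_2)=W_m(o_1;G_1)\,W_m(o_2;G_2),\qquad m=0,1,2,\dots. \]
   Context: A graph $G=(V,E)$ consists of a non-empty (finite or infinite) set $V$ and a set $E$ of two-point subsets of $V$ (so undirected, no loops, no multiple edges); $x\sim y$ means $\{x,y\}\in E$. All graphs are assumed locally finite, i.e. every vertex has finitely many adjacent vertices. The adjacency matrix $A$ of $G$ is indexed by $V\times V$ with $(A)_{xy}=1$ if $x\sim y$ and $(A)_{xy}=0$ otherwise; its powers are well defined by local finiteness. For $o\in V$, $W_m(o;G)=(A^m)_{oo}$ is the number of $m$-step walks from $o$ to itself, i.e. of sequences $o=x_0\sim x_1\sim\dots\sim x_m=o$, with $W_0(o;G)=1$. The Kronecker product $G_1\times_K G_2$ of $G_1=(V_1,E_1)$ and $G_2=(V_2,E_2)$ is the graph on $V_1\times V_2$ with adjacency relation $(x,y)\sim(x',y')$ if and only if $x\sim x'$ in $G_1$ and $y\sim y'$ in $G_2$. *)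

theory Defs
  imports Main
begin

record 'v ugraph =
  verts :: "'v set"
  edges :: "'v set set"

definition adj :: "'v ugraph \<Rightarrow> 'v \<Rightarrow> 'v \<Rightarrow> bool" where
  "adj G x y \<longleftrightarrow> {x, y} \<in> edges G"

locale simple_graph =
  fixes G :: "'v ugraph"
  assumes verts_nonempty: "verts G \<noteq> {}"
    and edges_two_point: "e \<in> edges G \<Longrightarrow> e \<subseteq> verts G \<and> card e = 2"

locale locally_finite_graph = simple_graph G for G :: "'v ugraph" +
  assumes locally_finite: "x \<in> verts G \<Longrightarrow> finite {y \<in> verts G. adj G x y}"

definition adjacency_matrix :: "'v ugraph \<Rightarrow> 'v \<Rightarrow> 'v \<Rightarrow> nat" where
  "adjacency_matrix G x y = (if adj G x y then 1 else 0)"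

text \<open>
  The index set \<open>V\<close> may be infinite, and a sum over an infinite set is \<open>0\<close> by convention.
  Hence the sum defining an entry of a product ranges over the nonzero terms only. For powers
  of the adjacency matrix of a locally finite graph there are finitely many of these
  (\<open>finite_power_support\<close> below), so this is the usual matrix product.
\<close>

definition matrix_mult ::
    "'v set \<Rightarrow> ('v \<Rightarrow> 'v \<Rightarrow> nat) \<Rightarrow> ('v \<Rightarrow> 'v \<Rightarrow> nat) \<Rightarrow> 'v \<Rightarrow> 'v \<Rightarrow> nat" where
  "matrix_mult V A B x y = (\<Sum>z \<in> {z \<in> V. A x z * B z y \<noteq> 0}. A x z * B z y)"

primrec matrix_power :: "'v set \<Rightarrow> ('v \<Rightarrow> 'v \<Rightarrow> nat) \<Rightarrow> nat \<Rightarrow> 'v \<Rightarrow> 'v \<Rightarrow> nat" where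
  "matrix_power V A 0 = (\<lambda>x y. if x = y then 1 else 0)"
| "matrix_power V A (Suc m) = matrix_mult V (matrix_power V A m) A"

definition W :: "nat \<Rightarrow> 'v \<Rightarrow> 'v ugraph \<Rightarrow> nat" where
  "W m v G = matrix_power (verts G) (adjacency_matrix G) m v v"

definition kronecker_product :: "'a ugraph \<Rightarrow> 'b ugraph \<Rightarrow> ('a \<times> 'b) ugraph"
    (infixl "\<times>\<^sub>K" 70) where
  "G1 \<times>\<^sub>K G2 =
     \<lparr> verts = verts G1 \<times> verts G2,
       edges = {{(x, y), (x', y')} | x y x' y'. adj G1 x x' \<and> adj G2 y y'} \<rparr>"

lemma adj_sym: "adj G x y \<longleftrightarrow> adj G y x"
  by (simp add: adj_def insert_commute)

lemma (in simple_graph) adj_verts: "adj G x y \<Longrightarrow> x \<in> verts G \<and> y \<in> verts G"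
  unfolding adj_def using edges_two_point[of "{x, y}"] by simp

lemma (in simple_graph) adj_irrefl: "\<not> adj G x x"
  unfolding adj_def using edges_two_point[of "{x, x}"] by auto

lemma adj_kronecker_product:
  "adj (G1 \<times>\<^sub>K G2) (x, y) (x', y') \<longleftrightarrow> adj G1 x x' \<and> adj G2 y y'"
  by (auto simp: kronecker_product_def adj_def doubleton_eq_iff insert_commute)

lemma locally_finite_graph_kronecker_product:
  assumes "locally_finite_graph G1" and "locally_finite_graph G2"
  shows "locally_finite_graph (G1 \<times>\<^sub>K G2)"
proof -
  interpret G1: locally_finite_graph G1 by fact
  interpret G2: locally_finite_graph G2 by fact
  show ?thesis
  proof
    show "verts (G1 \<times>\<^sub>K G2) \<noteq> {}"
      using G1.verts_nonempty G2.verts_nonempty by (auto simp: kronecker_product_def)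
  next
    fix e assume "e \<in> edges (G1 \<times>\<^sub>K G2)"
    then obtain x y x' y' where e: "e = {(x, y), (x', y')}" "adj G1 x x'" "adj G2 y y'"
      by (auto simp: kronecker_product_def)
    then have "x \<noteq> x'" using G1.adj_irrefl by auto
    then show "e \<subseteq> verts (G1 \<times>\<^sub>K G2) \<and> card e = 2"
      using e G1.adj_verts[of x x'] G2.adj_verts[of y y']
      by (auto simp: kronecker_product_def)
  next
    fix p assume p: "p \<in> verts (G1 \<times>\<^sub>K G2)"
    obtain x y where xy: "p = (x, y)" by force
    have "{q \<in> verts (G1 \<times>\<^sub>K G2). adj (G1 \<times>\<^sub>K G2) p q} \<subseteq>
        {x' \<in> verts G1. adj G1 x x'} \<times> {y' \<in> verts G2. adj G2 y y'}"
      using xy by (auto simp: adj_kronecker_product) (auto simp: kronecker_product_def)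
    moreover have "x \<in> verts G1" "y \<in> verts G2"
      using p xy by (auto simp: kronecker_product_def)
    ultimately show "finite {q \<in> verts (G1 \<times>\<^sub>K G2). adj (G1 \<times>\<^sub>K G2) p q}"
      by (auto intro: finite_subset[OF _ finite_cartesian_product] G1.locally_finite G2.locally_finite)
  qed
qed

lemma (in locally_finite_graph) finite_power_support:
  assumes "y \<in> verts G"
  shows "finite {z \<in> verts G. M x z * adjacency_matrix G z y \<noteq> 0}"
  by (rule finite_subset[OF _ locally_finite[OF assms]])
     (auto simp: adjacency_matrix_def adj_sym split: if_splits)

definition walks :: "nat \<Rightarrow> 'v \<Rightarrow> 'v \<Rightarrow> 'v ugraph \<Rightarrow> 'v list set" where
  "walks m x y G = {xs. length xs = Suc m \<and> set xs \<subseteq> verts G \<and> xs ! 0 = x \<and> xs ! m = y \<and>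
     (\<forall>i<m. adj G (xs ! i) (xs ! Suc i))}"

lemma walks_Suc:
  assumes "y \<in> verts G"
  shows "walks (Suc m) x y G =
    (\<Union>z \<in> {z \<in> verts G. adj G z y}. (\<lambda>xs. xs @ [y]) ` walks m x z G)"
proof (intro equalityI subsetI)
  fix xs assume xs: "xs \<in> walks (Suc m) x y G"
  then have "xs \<noteq> []" by (auto simp: walks_def)
  then obtain ys w where ys: "xs = ys @ [w]" by (metis rev_exhaust)
  have len: "length ys = Suc m" and w: "w = y" using xs ys by (auto simp: walks_def nth_append)
  have steps: "\<forall>i<Suc m. adj G (xs ! i) (xs ! Suc i)" using xs by (simp add: walks_def)
  have "adj G (ys ! i) (ys ! Suc i)" if "i < m" for i
    using steps[rule_format, of i] that len by (simp add: ys nth_append)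
  moreover have "adj G (ys ! m) y"
    using steps[rule_format, of m] len w by (simp add: ys nth_append)
  moreover have "ys ! m \<in> verts G" using xs ys len by (auto simp: walks_def)
  moreover have "set ys \<subseteq> verts G" "ys ! 0 = x"
    using xs ys len by (auto simp: walks_def nth_append)
  ultimately show "xs \<in> (\<Union>z \<in> {z \<in> verts G. adj G z y}. (\<lambda>xs. xs @ [y]) ` walks m x z G)"
    using ys w len by (auto simp: walks_def)
next
  fix xs assume "xs \<in> (\<Union>z \<in> {z \<in> verts G. adj G z y}. (\<lambda>xs. xs @ [y]) ` walks m x z G)"
  then show "xs \<in> walks (Suc m) x y G"
    using assms by (auto simp: walks_def nth_append less_Suc_eq)
qed

lemma (in locally_finite_graph) matrix_power_eq_card_walks:
  assumes "x \<in> verts G" and "y \<in> verts G"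
  shows "finite (walks m x y G) \<and>
    matrix_power (verts G) (adjacency_matrix G) m x y = card (walks m x y G)"
  using assms(2)
proof (induction m arbitrary: y)
  case 0
  have "walks 0 x y G = (if x = y then {[x]} else {})"
    using assms(1) by (auto simp: walks_def length_Suc_conv)
  then show ?case by simp
next
  case (Suc m)
  let ?N = "{z \<in> verts G. adj G z y}"
  let ?P = "matrix_power (verts G) (adjacency_matrix G) m"
  have fin: "finite ?N" using locally_finite[OF Suc.prems] by (simp add: adj_sym)
  have "matrix_power (verts G) (adjacency_matrix G) (Suc m) x y = (\<Sum>z\<in>?N. ?P x z)"
    unfolding matrix_power.simps matrix_mult_def
    by (rule sum.mono_neutral_cong_left[OF fin])
       (auto simp: adjacency_matrix_def split: if_splits)
  also have "\<dots> = (\<Sum>z\<in>?N. card ((\<lambda>xs. xs @ [y]) ` walks m x z G))"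
    using Suc.IH by (intro sum.cong) (auto simp: card_image inj_on_def)
  also have "\<dots> = card (\<Union>z\<in>?N. (\<lambda>xs. xs @ [y]) ` walks m x z G)"
    using fin Suc.IH by (intro card_UN_disjoint[symmetric]) (auto simp: walks_def)
  finally show ?case
    using fin Suc.IH by (auto simp: walks_Suc[OF Suc.prems])
qed

corollary (in locally_finite_graph) W_eq_card_walks:
  "v \<in> verts G \<Longrightarrow> W m v G = card (walks m v v G)"
  by (simp add: W_def matrix_power_eq_card_walks)

end

theory Submission
  imports Defs
begin

text \<open>
  The adjacency matrix of \<open>G1 \<times>\<^sub>K G2\<close> is the Kronecker (tensor) product \<open>A1 \<otimes> A2\<close> of the two
  adjacency matrices: a step in the product graph is a step in each factor. The mixed-product
  rule \<open>(A1 \<otimes> A2) (B1 \<otimes> B2) = (A1 B1) \<otimes> (A2 B2)\<close> gives \<open>(A1 \<otimes> A2)^m = A1^m \<otimes> A2^m\<close> by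
  induction, and the diagonal entry at \<open>(o1, o2)\<close> is the claim. In terms of walks, a closed walk
  in the product is a pair of closed walks of the same length, one in each factor.
\<close>

definition kronecker_matrix ::
    "('a \<Rightarrow> 'a \<Rightarrow> nat) \<Rightarrow> ('b \<Rightarrow> 'b \<Rightarrow> nat) \<Rightarrow> 'a \<times> 'b \<Rightarrow> 'a \<times> 'b \<Rightarrow> nat" where
  "kronecker_matrix A B p q = A (fst p) (fst q) * B (snd p) (snd q)"

lemma adjacency_matrix_kronecker_product:
  "adjacency_matrix (G1 \<times>\<^sub>K G2) =
    kronecker_matrix (adjacency_matrix G1) (adjacency_matrix G2)"
  by (auto simp: fun_eq_iff adjacency_matrix_def kronecker_matrix_def adj_kronecker_product)

text \<open>
  The mixed-product rule. Since \<open>nat\<close> has no zero divisors, the terms that contribute to an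
  entry on the left are indexed by exactly the product of the two index sets on the right, so
  the double sum factors. When one of the two index sets on the right is infinite, both sides
  are \<open>0\<close>, the value given to infinite sums.
\<close>

lemma matrix_mult_kronecker_matrix:
  "matrix_mult (V1 \<times> V2) (kronecker_matrix A1 A2) (kronecker_matrix B1 B2) =
    kronecker_matrix (matrix_mult V1 A1 B1) (matrix_mult V2 A2 B2)"
proof (intro ext)
  fix p q :: "'a \<times> 'b"
  let ?f = "\<lambda>z. A1 (fst p) z * B1 z (fst q)"
  let ?g = "\<lambda>w. A2 (snd p) w * B2 w (snd q)"
  let ?S = "{z \<in> V1. ?f z \<noteq> 0}"
  let ?T = "{w \<in> V2. ?g w \<noteq> 0}"
  have "matrix_mult (V1 \<times> V2) (kronecker_matrix A1 A2) (kronecker_matrix B1 B2) p q =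
      (\<Sum>(z, w) \<in> ?S \<times> ?T. ?f z * ?g w)"
    unfolding matrix_mult_def kronecker_matrix_def
    by (rule sum.cong) (auto simp: ac_simps)
  also have "\<dots> = sum ?f ?S * sum ?g ?T"
    by (simp only: sum_product sum.cartesian_product)
  finally show "matrix_mult (V1 \<times> V2) (kronecker_matrix A1 A2) (kronecker_matrix B1 B2) p q =
      kronecker_matrix (matrix_mult V1 A1 B1) (matrix_mult V2 A2 B2) p q"
    by (simp only: matrix_mult_def kronecker_matrix_def)
qed

lemma matrix_power_kronecker_matrix:
  "matrix_power (V1 \<times> V2) (kronecker_matrix A1 A2) m =
    kronecker_matrix (matrix_power V1 A1 m) (matrix_power V2 A2 m)"
proof (induction m)
  case 0
  show ?case by (auto simp: fun_eq_iff kronecker_matrix_def)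
next
  case (Suc m)
  then show ?case by (simp add: matrix_mult_kronecker_matrix)
qed

theorem theorem3p5:
  fixes G1 :: "'a ugraph" and G2 :: "'b ugraph" and o1 :: 'a and o2 :: 'b and m :: nat
  assumes "locally_finite_graph G1" and "locally_finite_graph G2"
    and "o1 \<in> verts G1" and "o2 \<in> verts G2"
  shows "W m (o1, o2) (G1 \<times>\<^sub>K G2) = W m o1 G1 * W m o2 G2"
proof -
  have "verts (G1 \<times>\<^sub>K G2) = verts G1 \<times> verts G2"
    by (simp add: kronecker_product_def)
  then show ?thesis
    by (simp add: W_def adjacency_matrix_kronecker_product matrix_power_kronecker_matrix)
      (simp add: kronecker_matrix_def)
qed

end
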